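(* Assume $f$ is $L$-smooth, $\zeta$-quasar-convex with respect to $x^*$, and $g\in\mathrm{ER}(\rho)$. Let $0<\gamma_k<\frac{\zeta}{2\rho+L}$ for all $k\in\mathbb{N}$ and let $r_0:=\|x^0-x^*\|^2$. Then the iterates of SGD satisfy $$\min_{t=0,\dots,k-1}\mathbb{E}[f(x^t)-f(x^* )]\le\frac{1}{\sum_{i=0}^{k-1}\gamma_i(\zeta-\gamma_i(2\rho+L))}\left[\frac{r_0}{2}+\sigma^2\sum_{t=0}^{k-1}\gamma_t^2\right].$$ Moreover, for $\gamma<\frac{\zeta}{2\rho+L}$ we have that: 1. If $\gamma_k=\gamma\equiv\frac12\frac{\zeta}{2\rho+L}$ for all $k\in\mathbb{N}$, then for all $k\in\mathbb{N}$, $$\min_{t=0,\dots,k-1}\mathbb{E}[f(x^t)-f(x^* )]\le 2r_0\frac{2\rho+L}{\zeta^2k}+\frac{\sigma^2}{2\rho+L}.$$ 2. Suppose SGD is run for $T$ iterations. If $\gamma_k=\frac{\gamma}{\sqrt T}$ for all $k=0,\dots,T-1$, then $$\min_{t=0,\dots,T-1}\mathbb{E}[f(x^t)-f(x^* )]\le\frac{r_0+2\gamma^2\sigma^2}{\gamma\sqrt T}.$$ 3. If $\gamma_k=\frac{\gamma}{\sqrt{k+1}}$ for all $k\in\mathbb{N}$, then for all $k\in\mathbb{N}$, $$\min_{t=0,\dots,k-1}\mathbb{E}[f(x^t)-f(x^* )]\le\frac{1}{4\gamma}\,\frac{r_0+2\gamma^2\sigma^2(\log(k)+1)}{\zeta(\sqrt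 k-1)-\gamma(\rho+L/2)(\log(k)+1)},$$ which is a convergence rate of $\mathcal{O}\left(\frac{\log(k)}{\sqrt k}\right)$.
   Context: $f_1,\dots,f_n:\mathbb{R}^d\to\mathbb{R}$ are differentiable, $f=\frac1n\sum_i f_i$, and the set $\mathcal{X}^*$ of global minimizers of $f$ is nonempty; $x^*\in\mathcal{X}^*$. A sampling vector is a random vector $v\in\mathbb{R}^n$ with nonnegative entries and $\mathbb{E}[v_i]=1$ for all $i$; $f_v=\frac1n\sum_iv_if_i$ and $g(x)=\nabla f_v(x)$, so $\mathbb{E}[g(x)]=\nabla f(x)$. SGD started from $x^0$ iterates $x^{k+1}=x^k-\gamma_k g(x^k)$, where the stochastic gradients $g(x^k)=\nabla f_{v^k}(x^k)$ use i.i.d. copies $v^0,v^1,\dots$ of $v$. The gradient noise $\sigma^2:=\sup_{x^*\in\mathcal{X}^*}\mathbb{E}\|g(x^* )\|^2$ is assumed finite. $f$ is $L$-smooth if $f(z)-f(x)\le\langle\nabla f(x),z-x\rangle+\frac L2\|z-x\|^2$ for all $x,z\in\mathbb{R}^d$. For $\zeta\in(0,1]$, $f$ is $\zeta$-quasar-convex with respect to $x^*$ if $f(x^* )\ge f(x)+\frac1\zeta\langle\nabla f(x),x^*-x\rangle$ for all $x$. $g\in\mathrm{ER}(\rho)$ (expected residual condition) means $\mathbb{E}\|g(x)-g(x^* )-(\nabla f(x)-\nabla f(x^* ))\|^2\le2\rho(f(x)-f(x^* ))$ for all $x\in\mathbb{R}^d$.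
   Formalization: Item 2 as printed fails for small ζ: the bound proved has ζγ√T in the denominator, and the printed bound is proved when ζ−γ(2ρ+L)/√T ≥ 1/2. Item 3's bound is proved only where its denominator is positive (it is negative at k=1); the O(log k/√k) rate is proved in full. *)

theory Defs
  imports "HOL-Probability.Probability" "HOL-Library.Landau_Symbols"
begin

definition grad :: "('a::real_inner \<Rightarrow> real) \<Rightarrow> 'a \<Rightarrow> 'a" where
  "grad h x = (THE D. GDERIV h x :> D)"

definition objective :: "('n::finite \<Rightarrow> real ^ 'd \<Rightarrow> real) \<Rightarrow> real ^ 'd \<Rightarrow> real" where
  "objective f x = (\<Sum>i\<in>UNIV. f i x) / real CARD('n)"

definition reweighted :: "('n::finite \<Rightarrow> real ^ 'd \<Rightarrow> real) \<Rightarrow> real ^ 'n \<Rightarrow> real ^ 'd \<Rightarrow> real" where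
  "reweighted f w x = (\<Sum>i\<in>UNIV. w $ i * f i x) / real CARD('n)"

text \<open>\<open>stoch_grad f (v \<omega>) x\<close> is the realisation at \<open>\<omega>\<close> of the stochastic gradient \<open>g(x)\<close>
  for the sampling vector \<open>v\<close>.\<close>

definition stoch_grad ::
    "('n::finite \<Rightarrow> real ^ 'd::finite \<Rightarrow> real) \<Rightarrow> real ^ 'n \<Rightarrow> real ^ 'd \<Rightarrow> real ^ 'd" where
  "stoch_grad f w = grad (reweighted f w)"

definition minimizers :: "('a \<Rightarrow> real) \<Rightarrow> 'a set" where
  "minimizers h = {x. \<forall>z. h x \<le> h z}"

definition sampling_vector :: "'w measure \<Rightarrow> ('w \<Rightarrow> real ^ 'n::finite) \<Rightarrow> bool" where
  "sampling_vector M v \<longleftrightarrow>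
     v \<in> borel_measurable M \<and>
     (AE \<omega> in M. \<forall>i. 0 \<le> v \<omega> $ i) \<and>
     (\<forall>i. integrable M (\<lambda>\<omega>. v \<omega> $ i) \<and> (\<integral>\<omega>. v \<omega> $ i \<partial>M) = 1)"

definition iid_copies ::
    "'w measure \<Rightarrow> (nat \<Rightarrow> 'w \<Rightarrow> 'b::topological_space) \<Rightarrow> 'u measure \<Rightarrow> ('u \<Rightarrow> 'b) \<Rightarrow> bool" where
  "iid_copies M V N v \<longleftrightarrow>
     prob_space.indep_vars M (\<lambda>_. borel) V UNIV \<and>
     (\<forall>k. distr M borel (V k) = distr N borel v)"

definition smooth :: "real \<Rightarrow> ('a::real_inner \<Rightarrow> real) \<Rightarrow> bool" where
  "smooth L h \<longleftrightarrow>
     (\<forall>x z. h z - h x \<le> inner (grad h x) (z - x) + L / 2 * (norm (z - x))\<^sup>2)"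

definition quasar_convex :: "real \<Rightarrow> ('a::real_inner \<Rightarrow> real) \<Rightarrow> 'a \<Rightarrow> bool" where
  "quasar_convex \<zeta> h y \<longleftrightarrow>
     (\<forall>x. h y \<ge> h x + 1 / \<zeta> * inner (grad h x) (y - x))"

text \<open>Integrability is explicit because the Bochner integral of a non-integrable function is 0.\<close>

definition expected_residual ::
    "'u measure \<Rightarrow> ('u \<Rightarrow> real ^ 'n::finite) \<Rightarrow> ('n \<Rightarrow> real ^ 'd::finite \<Rightarrow> real)
      \<Rightarrow> real ^ 'd \<Rightarrow> real \<Rightarrow> bool" where
  "expected_residual N v f y \<rho> \<longleftrightarrow>
     (\<forall>x. let R = (\<lambda>\<omega>. (norm (stoch_grad f (v \<omega>) x - stoch_grad f (v \<omega>) y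
                            - (grad (objective f) x - grad (objective f) y)))\<^sup>2)
          in integrable N R \<and>
             (\<integral>\<omega>. R \<omega> \<partial>N) \<le> 2 * \<rho> * (objective f x - objective f y))"

text \<open>The gradient noise is extended-real valued, so that a divergent second moment is not
  silently replaced by 0.\<close>

definition gradient_noise ::
    "'u measure \<Rightarrow> ('u \<Rightarrow> real ^ 'n::finite) \<Rightarrow> ('n \<Rightarrow> real ^ 'd::finite \<Rightarrow> real) \<Rightarrow> ennreal" where
  "gradient_noise N v f =
     (SUP y\<in>minimizers (objective f). \<integral>\<^sup>+\<omega>. ennreal ((norm (stoch_grad f (v \<omega>) y))\<^sup>2) \<partial>N)"

primrec sgd ::
    "('n::finite \<Rightarrow> real ^ 'd::finite \<Rightarrow> real) \<Rightarrow> (nat \<Rightarrow> 'w \<Rightarrow> real ^ 'n) \<Rightarrow> real ^ 'd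
      \<Rightarrow> (nat \<Rightarrow> real) \<Rightarrow> nat \<Rightarrow> 'w \<Rightarrow> real ^ 'd" where
  "sgd f V x0 \<eta> 0 \<omega> = x0"
| "sgd f V x0 \<eta> (Suc k) \<omega> =
     sgd f V x0 \<eta> k \<omega> - \<eta> k *\<^sub>R stoch_grad f (V k \<omega>) (sgd f V x0 \<eta> k \<omega>)"

text \<open>Only meaningful for \<open>k \<ge> 1\<close>, since the minimum of the empty set is unspecified.\<close>

definition best_gap ::
    "'w measure \<Rightarrow> (real ^ 'd \<Rightarrow> real) \<Rightarrow> real ^ 'd \<Rightarrow> (nat \<Rightarrow> 'w \<Rightarrow> real ^ 'd::finite) \<Rightarrow> nat \<Rightarrow> real" where
  "best_gap M h y X k = (MIN t\<in>{..<k}. \<integral>\<omega>. (h (X t \<omega>) - h y) \<partial>M)"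

end

theory Submission
  imports Defs "HOL-Real_Asymp.Real_Asymp"
begin

text \<open>With \<open>E\<^sub>t = E \<parallel>x\<^sup>t - xs\<parallel>\<^sup>2\<close>, expand the square in one step of SGD and condition on \<open>x\<^sup>t\<close>, which is
  independent of the sample \<open>v\<^sup>t\<close>. Unbiasedness and quasar convexity control the cross term; the
  expected residual together with \<open>\<parallel>\<nabla>f(x)\<parallel>\<^sup>2 \<le> 2 L (f(x) - f(xs))\<close> gives
  \<open>E \<parallel>g(x)\<parallel>\<^sup>2 \<le> 2 (2 \<rho> + L) (f(x) - f(xs)) + 2 \<sigma>\<^sup>2\<close>. Hence
  \<open>E\<^sub>t\<^sub>+\<^sub>1 + 2 \<gamma>\<^sub>t (\<zeta> - \<gamma>\<^sub>t (2 \<rho> + L)) E[f(x\<^sup>t) - f(xs)] \<le> E\<^sub>t + 2 \<gamma>\<^sub>t\<^sup>2 \<sigma>\<^sup>2\<close>, which telescopes; the three step-size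
  regimes are bounds on the two sums that appear.\<close>

section \<open>Gradients: existence, measurability, linearity in the sampling weights\<close>

lemma grad_eqI: "GDERIV h x :> D \<Longrightarrow> grad h x = D"
  unfolding grad_def
proof (rule the_equality)
  fix D' assume *: "GDERIV h x :> D" "GDERIV h x :> D'"
  then have "(\<lambda>y. y \<bullet> D') = (\<lambda>y. y \<bullet> D)"
    unfolding gderiv_def by (rule has_derivative_unique[rotated])
  then show "D' = D"
    by (metis inner_commute vector_eq_rdot)
qed

text \<open>The coordinates of the representing vector are the values of the derivative on
  \<open>Basis\<close>; together with uniqueness this discharges the definite description in
  \<open>grad\<close>.\<close>

lemma GDERIV_grad:
  fixes h :: "'a::euclidean_space \<Rightarrow> real"
  assumes "h differentiable (at x)"
  shows "GDERIV h x :> grad h x"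
proof -
  obtain h' where h': "(h has_derivative h') (at x)"
    using assms by (auto simp: differentiable_def)
  interpret linear h' using h' by (rule has_derivative_linear)
  have "h' y = y \<bullet> (\<Sum>b\<in>Basis. h' b *\<^sub>R b)" for y
  proof -
    have "h' y = h' (\<Sum>b\<in>Basis. (y \<bullet> b) *\<^sub>R b)"
      by (simp add: euclidean_representation)
    then show ?thesis
      by (simp add: sum scale inner_sum_right mult.commute)
  qed
  then have "GDERIV h x :> (\<Sum>b\<in>Basis. h' b *\<^sub>R b)"
    unfolding gderiv_def by (intro has_derivative_eq_rhs[OF h'] ext)
  then show ?thesis
    by (simp add: grad_eqI)
qed

text \<open>Mere differentiability does not make the gradient continuous. Each coordinate is
  nevertheless a pointwise limit of the difference quotients with increment
  \<open>1 / (n + 1)\<close>, and these are continuous in \<open>x\<close>.\<close>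

lemma borel_measurable_grad:
  fixes h :: "'a::euclidean_space \<Rightarrow> real"
  assumes "\<And>x. h differentiable (at x)"
  shows "grad h \<in> borel_measurable borel"
proof -
  have cont: "continuous_on UNIV h"
    using assms by (simp add: continuous_at_imp_continuous_on differentiable_imp_continuous_within)
  have "(\<lambda>x. grad h x \<bullet> b) \<in> borel_measurable borel" for b
  proof (rule borel_measurable_LIMSEQ_real)
    fix x
    have "((\<lambda>t. h (x + t *\<^sub>R b)) has_derivative (\<lambda>t. (t *\<^sub>R b) \<bullet> grad h x)) (at 0)"
      by (rule has_derivative_compose[of "\<lambda>t. x + t *\<^sub>R b" "\<lambda>t. t *\<^sub>R b" 0 UNIV h])
        (auto intro!: derivative_eq_intros GDERIV_grad[OF assms, unfolded gderiv_def])
    then have "((\<lambda>t. h (x + t *\<^sub>R b)) has_field_derivative (grad h x \<bullet> b)) (at 0)"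
      unfolding has_field_derivative_def
      by (rule has_derivative_eq_rhs) (simp add: fun_eq_iff inner_commute mult.commute)
    then have "((\<lambda>t. (h (x + t *\<^sub>R b) - h x) / t) \<longlongrightarrow> grad h x \<bullet> b) (at 0)"
      by (simp add: DERIV_def)
    moreover have "filterlim (\<lambda>n. inverse (real (Suc n))) (at 0) sequentially"
      using LIMSEQ_inverse_real_of_nat by (simp add: filterlim_at)
    ultimately show "(\<lambda>n. (h (x + inverse (real (Suc n)) *\<^sub>R b) - h x) / inverse (real (Suc n)))
        \<longlonglongrightarrow> grad h x \<bullet> b"
      by (rule filterlim_compose)
  next
    fix n
    show "(\<lambda>x. (h (x + inverse (real (Suc n)) *\<^sub>R b) - h x) / inverse (real (Suc n)))
        \<in> borel_measurable borel"
      by (intro borel_measurable_continuous_onI continuous_intros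
          continuous_on_compose2[OF cont]) auto
  qed
  then show ?thesis
    by (subst borel_measurable_euclidean_space) auto
qed

lemma norm_diff_scaleR_squared:
  "(norm (a - s *\<^sub>R y))\<^sup>2 = (norm a)\<^sup>2 - 2 * s * (y \<bullet> a) + s\<^sup>2 * (norm y)\<^sup>2"
  unfolding power2_norm_eq_inner
  by (simp add: inner_diff_left inner_diff_right inner_commute power2_eq_square algebra_simps)

text \<open>Linearity in the weights \<open>w\<close> is what later yields joint measurability in
  \<open>(w, x)\<close>, unbiasedness, and, with unit weights, the formula for the full
  gradient.\<close>

lemma stoch_grad_eq:
  fixes f :: "'n::finite \<Rightarrow> real ^ 'd::finite \<Rightarrow> real"
  assumes "\<And>i x. f i differentiable (at x)"
  shows "stoch_grad f w x = (\<Sum>i\<in>UNIV. (w $ i / real CARD('n)) *\<^sub>R grad (f i) x)"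
proof -
  have "((\<lambda>x. \<Sum>i\<in>UNIV. (w $ i / real CARD('n)) * f i x) has_derivative
      (\<lambda>y. \<Sum>i\<in>UNIV. (w $ i / real CARD('n)) * (y \<bullet> grad (f i) x))) (at x)"
    by (intro has_derivative_sum has_derivative_mult_right
        GDERIV_grad[OF assms, unfolded gderiv_def])
  moreover have "reweighted f w = (\<lambda>x. \<Sum>i\<in>UNIV. (w $ i / real CARD('n)) * f i x)"
    by (simp add: reweighted_def fun_eq_iff sum_divide_distrib)
  ultimately show ?thesis
    unfolding stoch_grad_def by (intro grad_eqI) (simp add: gderiv_def inner_sum_right)
qed

lemma objective_eq_reweighted: "objective f = reweighted f (\<chi> i. 1)"
  by (simp add: objective_def reweighted_def fun_eq_iff)

lemma grad_objective_eq:
  fixes f :: "'n::finite \<Rightarrow> real ^ 'd::finite \<Rightarrow> real"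
  assumes "\<And>i x. f i differentiable (at x)"
  shows "grad (objective f) x = (\<Sum>i\<in>UNIV. (1 / real CARD('n)) *\<^sub>R grad (f i) x)"
  using stoch_grad_eq[OF assms, where w = "\<chi> i. 1"]
  by (simp add: stoch_grad_def objective_eq_reweighted)

lemma borel_measurable_stoch_grad:
  fixes f :: "'n::finite \<Rightarrow> real ^ 'd::finite \<Rightarrow> real"
  assumes "\<And>i x. f i differentiable (at x)"
    and "W \<in> borel_measurable A" and "X \<in> borel_measurable A"
  shows "(\<lambda>a. stoch_grad f (W a) (X a)) \<in> borel_measurable A"
proof -
  have "(\<lambda>w::real^'n. w $ i) \<in> borel_measurable borel" for i
    by (intro borel_measurable_continuous_onI continuous_intros)
  then have "(\<lambda>a. W a $ i) \<in> borel_measurable A" for i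
    by (rule measurable_compose[OF assms(2)])
  moreover have "(\<lambda>a. grad (f i) (X a)) \<in> borel_measurable A" for i
    by (rule measurable_compose[OF assms(3) borel_measurable_grad[OF assms(1)]])
  ultimately show ?thesis
    unfolding stoch_grad_eq[OF assms(1)] by measurable
qed

section \<open>Smooth functions near a minimizer\<close>

text \<open>Minimises the smoothness bound along the ray from \<open>x\<close> in direction \<open>- grad h x\<close>. No sign is
  assumed for \<open>L\<close>: if \<open>L \<le> 0\<close>, the bound forces \<open>h\<close> to be constant.\<close>

lemma smooth_norm_grad_le:
  assumes "smooth L h" and y: "y \<in> minimizers h"
  shows "(norm (grad h x))\<^sup>2 \<le> 2 * L * (h x - h y)"
proof -
  have hy: "h y \<le> h z" for z using y by (simp add: minimizers_def)
  have ray: "s * (norm (grad h z))\<^sup>2 - L / 2 * s\<^sup>2 * (norm (grad h z))\<^sup>2 \<le> h z - h y" for s z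
  proof -
    have "h (z - s *\<^sub>R grad h z) - h z \<le>
        grad h z \<bullet> (- (s *\<^sub>R grad h z)) + L / 2 * (norm (- (s *\<^sub>R grad h z)))\<^sup>2"
      using assms(1)[unfolded smooth_def, rule_format, where x = z and z = "z - s *\<^sub>R grad h z"]
      by simp
    then show ?thesis
      using hy[of "z - s *\<^sub>R grad h z"]
      by (simp add: power2_norm_eq_inner[symmetric] power_mult_distrib)
  qed
  show ?thesis
  proof (cases "0 < L")
    case True
    have "2 * L * (1 / L * (norm (grad h x))\<^sup>2 - L / 2 * (1 / L)\<^sup>2 * (norm (grad h x))\<^sup>2)
        \<le> 2 * L * (h x - h y)"
      using True by (intro mult_left_mono ray) auto
    then show ?thesis
      using True by (simp add: field_simps power2_eq_square)
  next
    case False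
    have zero: "grad h z = 0" for z
    proof (rule ccontr)
      assume "grad h z \<noteq> 0"
      then have pos: "0 < (norm (grad h z))\<^sup>2" by simp
      define s where "s = (h z - h y) / (norm (grad h z))\<^sup>2 + 1"
      have "s * (norm (grad h z))\<^sup>2 = h z - h y + (norm (grad h z))\<^sup>2"
        using pos by (simp add: s_def distrib_right)
      moreover have "L / 2 * s\<^sup>2 * (norm (grad h z))\<^sup>2 \<le> 0"
        using False by (intro mult_nonpos_nonneg) (auto intro: mult_nonpos_nonneg)
      ultimately show False using ray[of s z] pos by linarith
    qed
    have "h x - h y \<le> L / 2 * (norm (x - y))\<^sup>2"
      using assms(1)[unfolded smooth_def, rule_format, where x = y and z = x] zero[of y] by simp
    also have "\<dots> \<le> 0"
      using False by (intro mult_nonpos_nonneg) auto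
    finally show ?thesis
      using hy[of x] zero[of x] by simp
  qed
qed

text \<open>The gradient vanishes at \<open>y\<close>, so only the quadratic term of the smoothness
  bound survives. This makes the gap integrable whenever the squared distance is.\<close>

lemma smooth_gap_le:
  assumes "smooth L h" and y: "y \<in> minimizers h"
  shows "h x - h y \<le> L / 2 * (norm (x - y))\<^sup>2"
proof -
  have "grad h y = 0" using smooth_norm_grad_le[OF assms, of y] by simp
  then show ?thesis
    using assms(1)[unfolded smooth_def, rule_format, where x = y and z = x] by simp
qed

lemma smooth_nonneg:
  fixes h :: "'a::euclidean_space \<Rightarrow> real"
  assumes "smooth L h" and y: "y \<in> minimizers h"
  shows "0 \<le> L"
proof -
  obtain b :: 'a where b: "b \<in> Basis" using nonempty_Basis by blast
  have "0 \<le> h (y + b) - h y" using y by (simp add: minimizers_def)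
  also have "\<dots> \<le> L / 2 * (norm b)\<^sup>2"
    using smooth_gap_le[OF assms, of "y + b"] by simp
  finally show ?thesis using b by simp
qed

section \<open>Integration over independent variables\<close>

text \<open>Independence turns the joint law into a product of laws, and Tonelli splits the
  integral. Working with nonnegative integrands allows its use before any integrability is
  known.\<close>

lemma (in prob_space) nn_integral_indep_var:
  assumes ind: "indep_var S X T Y" and \<Phi>: "\<Phi> \<in> borel_measurable (S \<Otimes>\<^sub>M T)"
  shows "(\<integral>\<^sup>+\<omega>. \<Phi> (X \<omega>, Y \<omega>) \<partial>M) = (\<integral>\<^sup>+\<omega>. \<integral>\<^sup>+\<omega>'. \<Phi> (X \<omega>, Y \<omega>') \<partial>M \<partial>M)"
proof -
  note X = indep_var_rv1[OF ind] and Y = indep_var_rv2[OF ind]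
  interpret Y: prob_space "distr M T Y" by (rule prob_space_distr[OF Y])
  have \<Phi>1: "\<Phi> \<in> borel_measurable (distr M S X \<Otimes>\<^sub>M distr M T Y)"
    using \<Phi> by (simp cong: measurable_cong_sets)
  have \<Phi>2: "\<Phi> \<in> borel_measurable (S \<Otimes>\<^sub>M distr M T Y)"
    using \<Phi> by (simp cong: measurable_cong_sets)
  have "(\<integral>\<^sup>+\<omega>. \<Phi> (X \<omega>, Y \<omega>) \<partial>M) = integral\<^sup>N (distr M (S \<Otimes>\<^sub>M T) (\<lambda>\<omega>. (X \<omega>, Y \<omega>))) \<Phi>"
    using X Y \<Phi> by (subst nn_integral_distr) auto
  also have "\<dots> = integral\<^sup>N (distr M S X \<Otimes>\<^sub>M distr M T Y) \<Phi>"
    using ind by (simp add: indep_var_distribution_eq)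
  also have "\<dots> = (\<integral>\<^sup>+x. \<integral>\<^sup>+y. \<Phi> (x, y) \<partial>distr M T Y \<partial>distr M S X)"
    by (rule Y.nn_integral_fst[OF \<Phi>1, symmetric])
  also have "\<dots> = (\<integral>\<^sup>+\<omega>. \<integral>\<^sup>+y. \<Phi> (X \<omega>, y) \<partial>distr M T Y \<partial>M)"
    using Y.borel_measurable_nn_integral_fst[OF \<Phi>2] by (intro nn_integral_distr[OF X]) simp
  also have "\<dots> = (\<integral>\<^sup>+\<omega>. \<integral>\<^sup>+\<omega>'. \<Phi> (X \<omega>, Y \<omega>') \<partial>M \<partial>M)"
    using measurable_space[OF X] \<Phi>
    by (intro nn_integral_cong nn_integral_distr[OF Y]) (auto intro: measurable_compose[OF measurable_Pair1'])
  finally show ?thesis .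
qed

section \<open>Sums of decreasing step sizes\<close>

lemma sum_inverse_le_ln:
  assumes "1 \<le> k"
  shows "(\<Sum>i<k. 1 / real (i + 1)) \<le> ln (real k) + 1"
  using assms
proof (induction k rule: dec_induct)
  case (step k)
  \<comment> \<open>That is, the new summand \<open>1 / (k + 1)\<close> is at most
    \<open>ln (k + 1) - ln k\<close>.\<close>
  have "ln (real k) - ln (real (Suc k)) \<le> (real k - real (Suc k)) / real (Suc k)"
    using step.hyps by (intro ln_diff_le) auto
  with step.IH show ?case by (simp add: add.commute)
qed simp

text \<open>With \<open>a = sqrt (i + 1)\<close> and \<open>b = sqrt (i + 2)\<close>, the identity
  \<open>(b - a) * (b + a) = 1\<close> and \<open>2 * a \<le> b + a\<close> give
  \<open>2 * (b - a) \<le> 1 / a\<close>; the left sides telescope.\<close>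

lemma sum_inverse_sqrt_ge: "2 * (sqrt (real (k + 1)) - 1) \<le> (\<Sum>i<k. 1 / sqrt (real (i + 1)))"
proof (induction k)
  case (Suc k)
  define a b where "a = sqrt (real (k + 1))" and "b = sqrt (real (k + 2))"
  have ab: "0 < a" "a \<le> b" "b * b - a * a = 1"
    by (auto simp: a_def b_def)
  have "(b - a) * (2 * a) \<le> (b - a) * (b + a)"
    using ab by (intro mult_left_mono) auto
  also have "\<dots> = 1" using ab by (simp add: algebra_simps)
  finally have "2 * (b - a) \<le> 1 / a" using ab by (simp add: field_simps)
  with Suc show ?case by (simp add: a_def b_def algebra_simps)
qed simp

section \<open>Dependence of the iterates on the samples\<close>

text \<open>The points \<open>a\<close> and \<open>b\<close> may lie in different spaces, so an
  iterate on \<open>M\<close> can be identified with the same recursion run on a restricted sample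
  sequence.\<close>

lemma sgd_cong:
  assumes "\<And>k. k < t \<Longrightarrow> W k a = W' k b"
  shows "sgd f W x0 \<eta> t a = sgd f W' x0 \<eta> t b"
  using assms by (induction t) auto

text \<open>Asking for measurability only when \<open>k < t\<close> lets the lemma apply on the
  product space indexed by \<open>{..<t}\<close>, where just those coordinates are
  available.\<close>

lemma borel_measurable_sgd:
  fixes f :: "'n::finite \<Rightarrow> real ^ 'd::finite \<Rightarrow> real"
  assumes "\<And>i x. f i differentiable (at x)"
    and "\<And>k. k < t \<Longrightarrow> W k \<in> borel_measurable A"
  shows "sgd f W x0 \<eta> t \<in> borel_measurable A"
  using assms(2)
proof (induction t)
  case (Suc t)
  then have [measurable]: "sgd f W x0 \<eta> t \<in> borel_measurable A" "W t \<in> borel_measurable A"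
    by auto
  have [measurable]: "(\<lambda>a. stoch_grad f (W t a) (sgd f W x0 \<eta> t a)) \<in> borel_measurable A"
    by (rule borel_measurable_stoch_grad[OF assms(1)]) auto
  show ?case by simp
next
  case 0
  have "sgd f W x0 \<eta> 0 = (\<lambda>_. x0)" by (simp add: fun_eq_iff)
  then show ?case by simp
qed

section \<open>Growth of the bound for decreasing steps\<close>

text \<open>In the denominator the square root dominates the logarithm whatever the sign of
  \<open>c\<close>, so its inverse is of order \<open>1 / sqrt k\<close>; the numerator is at most
  of order \<open>ln k\<close>.\<close>

lemma decreasing_bound_bigo:
  fixes \<gamma> \<zeta> a b c :: real
  assumes "0 < \<gamma>" and "0 < \<zeta>"
  shows "(\<lambda>k. 1 / (4 * \<gamma>) * ((a + b * (ln (real k) + 1)) / (\<zeta> * (sqrt (real k) - 1) - c * (ln (real k) + 1))))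
    \<in> O(\<lambda>k. ln (real k) / sqrt (real k))"
proof -
  have "(\<lambda>k. a + b * (ln (real k) + 1)) \<in> O(\<lambda>k. ln (real k))"
  proof (intro sum_in_bigo)
    show "(\<lambda>k. a) \<in> O(\<lambda>k. ln (real k))" by real_asymp
    have "(\<lambda>k. ln (real k) + 1) \<in> O(\<lambda>k. ln (real k))" by real_asymp
    then show "(\<lambda>k. b * (ln (real k) + 1)) \<in> O(\<lambda>k. ln (real k))" by simp
  qed
  moreover have "(\<lambda>k. inverse (\<zeta> * (sqrt (real k) - 1) - c * (ln (real k) + 1))) \<in> O(\<lambda>k. inverse (sqrt (real k)))"
    using assms(2) by real_asymp
  ultimately have "(\<lambda>k. (a + b * (ln (real k) + 1)) * inverse (\<zeta> * (sqrt (real k) - 1) - c * (ln (real k) + 1)))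
      \<in> O(\<lambda>k. ln (real k) * inverse (sqrt (real k)))"
    by (rule landau_o.big.mult)
  then have "(\<lambda>k. (a + b * (ln (real k) + 1)) / (\<zeta> * (sqrt (real k) - 1) - c * (ln (real k) + 1)))
      \<in> O(\<lambda>k. ln (real k) / sqrt (real k))"
    by (simp only: divide_inverse)
  then show ?thesis
    by (subst landau_o.big.cmult_in_iff) (use assms(1) in auto)
qed

section \<open>The SGD setting and its inequalities at a fixed point\<close>

text \<open>\<open>N\<close> carries a single sampling vector and \<open>M\<close> carries the whole
  run; the two spaces are linked only through the common law of the samples.\<close>

locale sgd_problem = M: prob_space M + N: prob_space N
  for M :: "'w measure" and N :: "'u measure" +
  fixes f :: "'n::finite \<Rightarrow> real ^ 'd::finite \<Rightarrow> real"
    and v :: "'u \<Rightarrow> real ^ 'n" and V :: "nat \<Rightarrow> 'w \<Rightarrow> real ^ 'n"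
    and xs x0 :: "real ^ 'd" and L \<zeta> \<rho> :: real
  assumes differentiable: "\<And>i x. f i differentiable (at x)"
    and minimizer: "xs \<in> minimizers (objective f)"
    and sampling: "sampling_vector N v"
    and copies: "iid_copies M V N v"
    and finite_noise: "gradient_noise N v f < \<infinity>"
    and smooth: "smooth L (objective f)"
    and zeta_pos: "0 < \<zeta>"
    and quasar: "quasar_convex \<zeta> (objective f) xs"
    and residual: "expected_residual N v f xs \<rho>"
begin

definition gap :: "real ^ 'd \<Rightarrow> real" where
  "gap x = objective f x - objective f xs"

text \<open>\<open>enn2real\<close> would send an infinite value to 0; \<open>finite_noise\<close>
  rules that case out.\<close>

definition noise :: real where
  "noise = enn2real (gradient_noise N v f)"

abbreviation "iter \<equiv> sgd f V x0"

lemma borel_measurable_v [measurable]: "v \<in> borel_measurable N"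
  using sampling by (simp add: sampling_vector_def)

lemma borel_measurable_V [measurable]: "V k \<in> borel_measurable M"
  using copies by (auto simp: iid_copies_def M.indep_vars_def)

lemma borel_measurable_iter [measurable]: "iter \<eta> t \<in> borel_measurable M"
  by (intro borel_measurable_sgd differentiable) simp

lemma borel_measurable_stoch_grad_v [measurable]: "(\<lambda>u. stoch_grad f (v u) x) \<in> borel_measurable N"
  by (intro borel_measurable_stoch_grad differentiable) simp_all

lemma borel_measurable_gap [measurable]: "gap \<in> borel_measurable borel"
proof -
  have [measurable]: "f i \<in> borel_measurable borel" for i
    using differentiable[of i]
    by (intro borel_measurable_continuous_onI)
      (simp add: continuous_at_imp_continuous_on differentiable_imp_continuous_within)
  show ?thesis unfolding gap_def objective_def by measurable
qed

lemma gap_nonneg: "0 \<le> gap x"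
  using minimizer by (simp add: gap_def minimizers_def)

lemma gap_le: "gap x \<le> L / 2 * (norm (x - xs))\<^sup>2"
  unfolding gap_def by (rule smooth_gap_le[OF smooth minimizer])

lemma grad_objective_le: "(norm (grad (objective f) x))\<^sup>2 \<le> 2 * L * gap x"
  unfolding gap_def by (rule smooth_norm_grad_le[OF smooth minimizer])

lemma grad_objective_minimizer: "grad (objective f) xs = 0"
  using grad_objective_le[of xs] by (simp add: gap_def)

lemma L_nonneg: "0 \<le> L"
  by (rule smooth_nonneg[OF smooth minimizer])

text \<open>No sign is assumed for \<open>\<rho>\<close>, but the expected residual is nonnegative.
  Wherever the gap is positive this gives \<open>0 \<le> \<rho>\<close>.\<close>

lemma rho_gap_nonneg: "0 \<le> \<rho> * gap x"
proof -
  let ?R = "\<lambda>u. (norm (stoch_grad f (v u) x - stoch_grad f (v u) xs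
    - (grad (objective f) x - grad (objective f) xs)))\<^sup>2"
  have "0 \<le> (\<integral>u. ?R u \<partial>N)"
    by (rule Bochner_Integration.integral_nonneg) simp
  also have "\<dots> \<le> 2 * \<rho> * gap x"
    using residual unfolding expected_residual_def gap_def Let_def by blast
  finally show ?thesis by simp
qed

lemma quasar_le: "\<zeta> * gap x \<le> grad (objective f) x \<bullet> (x - xs)"
proof -
  have "gap x \<le> (1 / \<zeta>) * (grad (objective f) x \<bullet> (x - xs))"
    using quasar[unfolded quasar_convex_def, rule_format, of x]
    by (simp add: gap_def inner_diff_right right_diff_distrib)
  then show ?thesis using zeta_pos by (simp add: field_simps)
qed

lemma noise_nonneg: "0 \<le> noise"
  by (simp add: noise_def)

section \<open>First and second moments of the stochastic gradient\<close>

text \<open>Unbiasedness, tested against a fixed vector so that only real-valued integrals occur; it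
  follows from linearity in the weights and \<open>E v_i = 1\<close>.\<close>

lemma stoch_grad_inner:
  "integrable N (\<lambda>u. stoch_grad f (v u) x \<bullet> y)"
  "(\<integral>u. stoch_grad f (v u) x \<bullet> y \<partial>N) = grad (objective f) x \<bullet> y"
proof -
  have v: "integrable N (\<lambda>u. v u $ i)" "(\<integral>u. v u $ i \<partial>N) = 1" for i
    using sampling by (auto simp: sampling_vector_def)
  have eq: "stoch_grad f (v u) x \<bullet> y =
      (\<Sum>i\<in>UNIV. v u $ i * ((grad (f i) x \<bullet> y) / real CARD('n)))" for u
    by (simp add: stoch_grad_eq[OF differentiable] inner_sum_left)
  show "integrable N (\<lambda>u. stoch_grad f (v u) x \<bullet> y)"
    unfolding eq by (intro Bochner_Integration.integrable_sum integrable_mult_left v)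
  show "(\<integral>u. stoch_grad f (v u) x \<bullet> y \<partial>N) = grad (objective f) x \<bullet> y"
    unfolding eq
    by (subst Bochner_Integration.integral_sum)
      (auto simp: v grad_objective_eq[OF differentiable] inner_sum_left intro!: integrable_mult_left)
qed

lemma stoch_grad_minimizer:
  "integrable N (\<lambda>u. (norm (stoch_grad f (v u) xs))\<^sup>2)"
  "(\<integral>u. (norm (stoch_grad f (v u) xs))\<^sup>2 \<partial>N) \<le> noise"
proof -
  have le: "(\<integral>\<^sup>+u. ennreal ((norm (stoch_grad f (v u) xs))\<^sup>2) \<partial>N) \<le> gradient_noise N v f"
    unfolding gradient_noise_def by (rule SUP_upper) (rule minimizer)
  show "integrable N (\<lambda>u. (norm (stoch_grad f (v u) xs))\<^sup>2)"
    using le_less_trans[OF le finite_noise] by (intro integrableI_bounded) auto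
  show "(\<integral>u. (norm (stoch_grad f (v u) xs))\<^sup>2 \<partial>N) \<le> noise"
    unfolding noise_def using le finite_noise
    by (subst integral_eq_nn_integral) (auto intro: enn2real_mono)
qed

text \<open>The stochastic gradient is split as \<open>g(x) = A + B + \<nabla>f(x)\<close> with \<open>B = g(xs)\<close> and \<open>A\<close> the
  expected-residual term; unbiasedness makes \<open>E \<parallel>g(x)\<parallel>\<^sup>2 = E \<parallel>A + B\<parallel>\<^sup>2 + \<parallel>\<nabla>f(x)\<parallel>\<^sup>2\<close>.\<close>

lemma stoch_grad_second_moment:
  "integrable N (\<lambda>u. (norm (stoch_grad f (v u) x))\<^sup>2)" (is "integrable N ?g2")
  "(\<integral>u. (norm (stoch_grad f (v u) x))\<^sup>2 \<partial>N) \<le> 2 * (2 * \<rho> + L) * gap x + 2 * noise"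
proof -
  define D where "D = grad (objective f) x"
  define A where "A u = stoch_grad f (v u) x - stoch_grad f (v u) xs - D" for u
  define B where "B u = stoch_grad f (v u) xs" for u
  have A: "integrable N (\<lambda>u. (norm (A u))\<^sup>2)" "(\<integral>u. (norm (A u))\<^sup>2 \<partial>N) \<le> 2 * \<rho> * gap x"
    using residual unfolding expected_residual_def A_def D_def gap_def
    by (auto simp: grad_objective_minimizer Let_def)
  have B: "integrable N (\<lambda>u. (norm (B u))\<^sup>2)" "(\<integral>u. (norm (B u))\<^sup>2 \<partial>N) \<le> noise"
    using stoch_grad_minimizer by (simp_all add: B_def)
  have gD: "integrable N (\<lambda>u. stoch_grad f (v u) x \<bullet> D)"
      "(\<integral>u. stoch_grad f (v u) x \<bullet> D \<partial>N) = (norm D)\<^sup>2"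
    using stoch_grad_inner by (simp_all add: D_def power2_norm_eq_inner)
  \<comment> \<open>Since \<open>g - D = A + B\<close>, expanding gives
    \<open>H - ?g2 = (norm (A - B))\<^sup>2\<close>, so \<open>H\<close> dominates pointwise. In
    expectation its last two terms combine to \<open>(norm D)\<^sup>2\<close>.\<close>
  define H where
    "H u = 2 * (norm (A u))\<^sup>2 + 2 * (norm (B u))\<^sup>2 + 2 * (stoch_grad f (v u) x \<bullet> D) - (norm D)\<^sup>2" for u
  have H: "integrable N H"
    unfolding H_def using A B gD by simp
  have bound: "?g2 u \<le> H u" for u
  proof -
    have "stoch_grad f (v u) x = A u + B u + D" by (simp add: A_def B_def)
    moreover have "0 \<le> (norm (A u - B u))\<^sup>2" by simp
    ultimately show ?thesis
      by (simp add: H_def power2_norm_eq_inner inner_add inner_diff inner_commute algebra_simps)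
  qed
  show int: "integrable N ?g2"
    using bound
    by (intro Bochner_Integration.integrable_bound[OF H])
      (auto intro: order_trans[OF _ abs_ge_self])
  have "integral\<^sup>L N ?g2 \<le> integral\<^sup>L N H"
    using bound by (intro integral_mono int H)
  also have "integral\<^sup>L N H = 2 * (\<integral>u. (norm (A u))\<^sup>2 \<partial>N) + 2 * (\<integral>u. (norm (B u))\<^sup>2 \<partial>N) + (norm D)\<^sup>2"
    unfolding H_def using A B gD by (simp add: N.prob_space)
  also have "\<dots> \<le> 2 * (2 * \<rho> * gap x) + 2 * noise + 2 * L * gap x"
    using A(2) B(2) grad_objective_le[of x] unfolding D_def by linarith
  finally show "integral\<^sup>L N ?g2 \<le> 2 * (2 * \<rho> + L) * gap x + 2 * noise"
    by (simp add: algebra_simps)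
qed

section \<open>One SGD step in expectation\<close>

text \<open>\<open>indep_var\<close> requires both random variables to have the same value type, so independence of
  \<open>x\<^sup>t\<close> and \<open>v\<^sup>t\<close> is expressed through restrictions of the whole sample sequence.\<close>

lemma nn_integral_iter:
  assumes [measurable]: "\<Phi> \<in> borel_measurable (borel \<Otimes>\<^sub>M borel)"
  shows "(\<integral>\<^sup>+\<omega>. \<Phi> (iter \<eta> t \<omega>, V t \<omega>) \<partial>M) = (\<integral>\<^sup>+\<omega>. \<integral>\<^sup>+u. \<Phi> (iter \<eta> t \<omega>, v u) \<partial>N \<partial>M)"
proof -
  let ?past = "\<lambda>\<omega>. restrict (\<lambda>i. V i \<omega>) {..<t}" and ?now = "\<lambda>\<omega>. restrict (\<lambda>i. V i \<omega>) {t}"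
  let ?iter = "sgd f (\<lambda>k h. h k) x0 \<eta> t"
  have ind: "M.indep_var (PiM {..<t} (\<lambda>_. borel)) ?past (PiM {t} (\<lambda>_. borel)) ?now"
    using copies by (intro M.indep_var_restrict[where I = UNIV]) (auto simp: iid_copies_def)
  have [measurable]: "?iter \<in> borel_measurable (PiM {..<t} (\<lambda>_. borel))"
    by (intro borel_measurable_sgd differentiable) auto
  have past: "?iter (?past \<omega>) = iter \<eta> t \<omega>" for \<omega>
    by (rule sgd_cong) simp
  \<comment> \<open>The inner integral depends only on the law of \<open>V t\<close>, so it can be
    moved to \<open>N\<close>.\<close>
  have law: "(\<integral>\<^sup>+\<omega>'. \<Phi> (x, V t \<omega>') \<partial>M) = (\<integral>\<^sup>+u. \<Phi> (x, v u) \<partial>N)" for x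
  proof -
    have "(\<integral>\<^sup>+\<omega>'. \<Phi> (x, V t \<omega>') \<partial>M) = (\<integral>\<^sup>+y. \<Phi> (x, y) \<partial>distr M borel (V t))"
      by (subst nn_integral_distr) auto
    also have "\<dots> = (\<integral>\<^sup>+y. \<Phi> (x, y) \<partial>distr N borel v)"
      using copies by (simp add: iid_copies_def)
    also have "\<dots> = (\<integral>\<^sup>+u. \<Phi> (x, v u) \<partial>N)"
      by (subst nn_integral_distr) auto
    finally show ?thesis .
  qed
  have "(\<lambda>p. \<Phi> (?iter (fst p), snd p t))
      \<in> borel_measurable (PiM {..<t} (\<lambda>_. borel) \<Otimes>\<^sub>M PiM {t} (\<lambda>_. borel))"
    by measurable
  from M.nn_integral_indep_var[OF ind this] show ?thesis
    by (simp add: past law)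
qed

text \<open>A crude bound that serves integrability only: nonnegativity of the square with the
  opposite sign of \<open>s\<close> absorbs the cross term.\<close>

lemma norm_step_le:
  "(norm (x - s *\<^sub>R y - xs))\<^sup>2 \<le> 2 * (norm (x - xs))\<^sup>2 + 2 * s\<^sup>2 * (norm y)\<^sup>2"
proof -
  have "0 \<le> (norm ((x - xs) - (- s) *\<^sub>R y))\<^sup>2" by simp
  moreover have "x - s *\<^sub>R y - xs = (x - xs) - s *\<^sub>R y" by simp
  ultimately show ?thesis
    by (simp only: norm_diff_scaleR_squared) simp
qed

lemma integrable_step: "integrable N (\<lambda>u. (norm (x - s *\<^sub>R stoch_grad f (v u) x - xs))\<^sup>2)"
proof (rule Bochner_Integration.integrable_bound)
  show "integrable N (\<lambda>u. 2 * (norm (x - xs))\<^sup>2 + 2 * s\<^sup>2 * (norm (stoch_grad f (v u) x))\<^sup>2)"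
    using stoch_grad_second_moment(1) by simp
  show "AE u in N. norm ((norm (x - s *\<^sub>R stoch_grad f (v u) x - xs))\<^sup>2)
      \<le> norm (2 * (norm (x - xs))\<^sup>2 + 2 * s\<^sup>2 * (norm (stoch_grad f (v u) x))\<^sup>2)"
    unfolding real_norm_def abs_power2 by (intro AE_I2 order_trans[OF norm_step_le abs_ge_self])
qed measurable

text \<open>Transfers a bound at fixed \<open>x\<close> to the random iterate by independence. The
  function \<open>R\<close> is left open because it is used twice: with a crude bound to obtain
  integrability, then with the sharp one to obtain descent.\<close>

lemma iter_step:
  assumes R: "\<And>x. (\<integral>u. (norm (x - \<eta> t *\<^sub>R stoch_grad f (v u) x - xs))\<^sup>2 \<partial>N) \<le> R x"
    and int: "integrable M (\<lambda>\<omega>. R (iter \<eta> t \<omega>))"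
  shows "integrable M (\<lambda>\<omega>. (norm (iter \<eta> (Suc t) \<omega> - xs))\<^sup>2)"
    and "(\<integral>\<omega>. (norm (iter \<eta> (Suc t) \<omega> - xs))\<^sup>2 \<partial>M) \<le> (\<integral>\<omega>. R (iter \<eta> t \<omega>) \<partial>M)"
proof -
  have R0: "0 \<le> R x" for x
    by (rule order_trans[OF _ R]) simp
  have [measurable]: "(\<lambda>p. stoch_grad f (snd p) (fst p)) \<in> borel_measurable (borel \<Otimes>\<^sub>M borel)"
    by (intro borel_measurable_stoch_grad differentiable) auto
  have "(\<integral>\<^sup>+\<omega>. ennreal ((norm (iter \<eta> (Suc t) \<omega> - xs))\<^sup>2) \<partial>M) =
      (\<integral>\<^sup>+\<omega>. (\<lambda>p. ennreal ((norm (fst p - \<eta> t *\<^sub>R stoch_grad f (snd p) (fst p) - xs))\<^sup>2))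
        (iter \<eta> t \<omega>, V t \<omega>) \<partial>M)"
    by simp
  also have "\<dots> = (\<integral>\<^sup>+\<omega>. \<integral>\<^sup>+u. ennreal ((norm (iter \<eta> t \<omega> -
      \<eta> t *\<^sub>R stoch_grad f (v u) (iter \<eta> t \<omega>) - xs))\<^sup>2) \<partial>N \<partial>M)"
    by (subst nn_integral_iter) auto
  also have "\<dots> \<le> (\<integral>\<^sup>+\<omega>. ennreal (R (iter \<eta> t \<omega>)) \<partial>M)"
    by (intro nn_integral_mono)
      (auto simp: nn_integral_eq_integral integrable_step intro!: ennreal_leI R)
  also have "\<dots> = ennreal (\<integral>\<omega>. R (iter \<eta> t \<omega>) \<partial>M)"
    using R0 by (intro nn_integral_eq_integral int) simp
  finally have le: "(\<integral>\<^sup>+\<omega>. ennreal ((norm (iter \<eta> (Suc t) \<omega> - xs))\<^sup>2) \<partial>M)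
      \<le> ennreal (\<integral>\<omega>. R (iter \<eta> t \<omega>) \<partial>M)" .
  have meas: "(\<lambda>\<omega>. (norm (iter \<eta> (Suc t) \<omega> - xs))\<^sup>2) \<in> borel_measurable M"
    using borel_measurable_iter[of \<eta> "Suc t"] by (simp del: sgd.simps)
  show "integrable M (\<lambda>\<omega>. (norm (iter \<eta> (Suc t) \<omega> - xs))\<^sup>2)"
    using le_less_trans[OF le ennreal_less_top] meas
    by (intro integrableI_bounded) (simp_all del: sgd.simps)
  then have "ennreal (\<integral>\<omega>. (norm (iter \<eta> (Suc t) \<omega> - xs))\<^sup>2 \<partial>M) \<le> ennreal (\<integral>\<omega>. R (iter \<eta> t \<omega>) \<partial>M)"
    using le by (subst nn_integral_eq_integral[symmetric]) auto
  then show "(\<integral>\<omega>. (norm (iter \<eta> (Suc t) \<omega> - xs))\<^sup>2 \<partial>M) \<le> (\<integral>\<omega>. R (iter \<eta> t \<omega>) \<partial>M)"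
    using R0 by (subst (asm) ennreal_le_iff) (auto intro: Bochner_Integration.integral_nonneg)
qed

lemma integrable_gap_of_dist:
  assumes "integrable M (\<lambda>\<omega>. (norm (X \<omega> - xs))\<^sup>2)" and [measurable]: "X \<in> borel_measurable M"
  shows "integrable M (\<lambda>\<omega>. gap (X \<omega>))"
proof (rule Bochner_Integration.integrable_bound)
  show "integrable M (\<lambda>\<omega>. L / 2 * (norm (X \<omega> - xs))\<^sup>2)"
    using assms(1) by simp
  have "\<bar>gap x\<bar> \<le> \<bar>L / 2 * (norm (x - xs))\<^sup>2\<bar>" for x
    using gap_nonneg[of x] gap_le[of x] by linarith
  then show "AE \<omega> in M. norm (gap (X \<omega>)) \<le> norm (L / 2 * (norm (X \<omega> - xs))\<^sup>2)"
    by simp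
qed measurable

text \<open>Induction on \<open>t\<close> for arbitrary real step sizes: the crude step bound
  involves only the squared distance and the gap, and the gap is dominated by the squared
  distance.\<close>

lemma integrable_dist: "integrable M (\<lambda>\<omega>. (norm (iter \<eta> t \<omega> - xs))\<^sup>2)"
proof (induction t)
  case (Suc t)
  have "(\<integral>u. (norm (x - \<eta> t *\<^sub>R stoch_grad f (v u) x - xs))\<^sup>2 \<partial>N)
      \<le> 2 * (norm (x - xs))\<^sup>2 + 2 * (\<eta> t)\<^sup>2 * (2 * (2 * \<rho> + L) * gap x + 2 * noise)" for x
  proof -
    have "(\<integral>u. (norm (x - \<eta> t *\<^sub>R stoch_grad f (v u) x - xs))\<^sup>2 \<partial>N)
        \<le> (\<integral>u. 2 * (norm (x - xs))\<^sup>2 + 2 * (\<eta> t)\<^sup>2 * (norm (stoch_grad f (v u) x))\<^sup>2 \<partial>N)"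
      using stoch_grad_second_moment(1) by (intro integral_mono integrable_step norm_step_le) auto
    also have "\<dots> = 2 * (norm (x - xs))\<^sup>2
        + 2 * (\<eta> t)\<^sup>2 * (\<integral>u. (norm (stoch_grad f (v u) x))\<^sup>2 \<partial>N)"
      using stoch_grad_second_moment(1) by (simp add: N.prob_space)
    also have "\<dots> \<le> 2 * (norm (x - xs))\<^sup>2 + 2 * (\<eta> t)\<^sup>2 * (2 * (2 * \<rho> + L) * gap x + 2 * noise)"
      by (intro add_left_mono mult_left_mono stoch_grad_second_moment(2)) auto
    finally show ?thesis .
  qed
  then show ?case
    by (rule iter_step(1)) (use Suc integrable_gap_of_dist[OF Suc borel_measurable_iter] in auto)
qed simp

lemma integrable_gap: "integrable M (\<lambda>\<omega>. gap (iter \<eta> t \<omega>))"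
  by (rule integrable_gap_of_dist[OF integrable_dist borel_measurable_iter])

text \<open>Nonnegativity of the step is what lets quasar convexity bound the cross term. The upper
  limit on the step enters later, where the weights of the gaps must be nonnegative.\<close>

lemma descent:
  assumes "0 \<le> \<eta> t"
  shows "(\<integral>\<omega>. (norm (iter \<eta> (Suc t) \<omega> - xs))\<^sup>2 \<partial>M)
      + 2 * (\<eta> t * (\<zeta> - \<eta> t * (2 * \<rho> + L))) * (\<integral>\<omega>. gap (iter \<eta> t \<omega>) \<partial>M)
    \<le> (\<integral>\<omega>. (norm (iter \<eta> t \<omega> - xs))\<^sup>2 \<partial>M) + 2 * noise * (\<eta> t)\<^sup>2"
proof -
  define s where "s = \<eta> t"
  define R where "R x = (norm (x - xs))\<^sup>2 - 2 * (s * (\<zeta> - s * (2 * \<rho> + L))) * gap x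
    + 2 * noise * s\<^sup>2" for x
  have "(\<integral>u. (norm (x - \<eta> t *\<^sub>R stoch_grad f (v u) x - xs))\<^sup>2 \<partial>N) \<le> R x" for x
  proof -
    have eq: "(norm (x - \<eta> t *\<^sub>R stoch_grad f (v u) x - xs))\<^sup>2 = (norm (x - xs))\<^sup>2
        - 2 * s * (stoch_grad f (v u) x \<bullet> (x - xs)) + s\<^sup>2 * (norm (stoch_grad f (v u) x))\<^sup>2" for u
      using norm_diff_scaleR_squared[of "x - xs" s "stoch_grad f (v u) x"]
      by (simp add: s_def algebra_simps)
    have "(\<integral>u. (norm (x - \<eta> t *\<^sub>R stoch_grad f (v u) x - xs))\<^sup>2 \<partial>N) = (norm (x - xs))\<^sup>2
        - 2 * s * (grad (objective f) x \<bullet> (x - xs))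
        + s\<^sup>2 * (\<integral>u. (norm (stoch_grad f (v u) x))\<^sup>2 \<partial>N)"
      unfolding eq using stoch_grad_second_moment(1) stoch_grad_inner
      by (simp add: N.prob_space)
    also have "\<dots> \<le> (norm (x - xs))\<^sup>2 - 2 * s * (\<zeta> * gap x)
        + s\<^sup>2 * (2 * (2 * \<rho> + L) * gap x + 2 * noise)"
      using assms
      by (intro add_mono diff_mono mult_left_mono quasar_le stoch_grad_second_moment(2))
        (auto simp: s_def)
    also have "\<dots> = R x"
      by (simp add: R_def power2_eq_square algebra_simps)
    finally show ?thesis .
  qed
  moreover have "integrable M (\<lambda>\<omega>. R (iter \<eta> t \<omega>))"
    unfolding R_def using integrable_dist integrable_gap by auto
  ultimately have "(\<integral>\<omega>. (norm (iter \<eta> (Suc t) \<omega> - xs))\<^sup>2 \<partial>M) \<le> (\<integral>\<omega>. R (iter \<eta> t \<omega>) \<partial>M)"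
    by (rule iter_step(2))
  also have "\<dots> = (\<integral>\<omega>. (norm (iter \<eta> t \<omega> - xs))\<^sup>2 \<partial>M)
      - 2 * (s * (\<zeta> - s * (2 * \<rho> + L))) * (\<integral>\<omega>. gap (iter \<eta> t \<omega>) \<partial>M) + 2 * noise * s\<^sup>2"
    unfolding R_def using integrable_dist integrable_gap by (simp add: M.prob_space)
  finally show ?thesis by (simp add: s_def)
qed

section \<open>Telescoping and the minimal gap\<close>

lemma descent_sum:
  assumes "\<And>t. t < k \<Longrightarrow> 0 \<le> \<eta> t"
  shows "(\<Sum>t<k. \<eta> t * (\<zeta> - \<eta> t * (2 * \<rho> + L)) * (\<integral>\<omega>. gap (iter \<eta> t \<omega>) \<partial>M))
    \<le> (norm (x0 - xs))\<^sup>2 / 2 + noise * (\<Sum>t<k. (\<eta> t)\<^sup>2)"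
proof -
  \<comment> \<open>The final squared distance is kept so that the induction telescopes; it is
    discarded afterwards as nonnegative.\<close>
  have "(\<integral>\<omega>. (norm (iter \<eta> k \<omega> - xs))\<^sup>2 \<partial>M)
      + 2 * (\<Sum>t<k. \<eta> t * (\<zeta> - \<eta> t * (2 * \<rho> + L)) * (\<integral>\<omega>. gap (iter \<eta> t \<omega>) \<partial>M))
    \<le> (norm (x0 - xs))\<^sup>2 + 2 * noise * (\<Sum>t<k. (\<eta> t)\<^sup>2)"
    using assms
  proof (induction k)
    case (Suc k)
    from Suc.IH Suc.prems descent[of \<eta> k] show ?case
      by (simp add: distrib_left del: sgd.simps)
  qed (simp add: M.prob_space)
  moreover have "0 \<le> (\<integral>\<omega>. (norm (iter \<eta> k \<omega> - xs))\<^sup>2 \<partial>M)"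
    by simp
  ultimately show ?thesis by linarith
qed

abbreviation "best \<equiv> \<lambda>\<eta>. best_gap M (objective f) xs (iter \<eta>)"

lemma best_le: "t < k \<Longrightarrow> best \<eta> k \<le> (\<integral>\<omega>. gap (iter \<eta> t \<omega>) \<partial>M)"
  unfolding best_gap_def gap_def by (intro Min_le) auto

text \<open>Permits replacing the sum of weights by a smaller number in
  \<open>best_gap_bound\<close>, and removes the absolute value in the asymptotic estimate.\<close>

lemma best_nonneg:
  assumes "1 \<le> k"
  shows "0 \<le> best \<eta> k"
proof -
  have "{..<k} \<noteq> {}" using assms by (auto simp: lessThan_empty_iff)
  moreover have "0 \<le> (\<integral>\<omega>. (objective f (iter \<eta> t \<omega>) - objective f xs) \<partial>M)" for t
    using gap_nonneg unfolding gap_def by simp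
  ultimately show ?thesis
    unfolding best_gap_def by (subst Min_ge_iff) auto
qed

text \<open>The minimum is at most every expected gap, hence the minimum times the total weight is
  at most the telescoped sum. Leaving \<open>S\<close> and \<open>Q\<close> free lets each step-size
  rule supply its own estimates of the two sums.\<close>

lemma best_gap_bound:
  assumes k: "1 \<le> k" and \<eta>: "\<And>t. t < k \<Longrightarrow> 0 < \<eta> t \<and> \<eta> t < \<zeta> / (2 * \<rho> + L)"
    and S: "0 < S" "S \<le> (\<Sum>t<k. \<eta> t * (\<zeta> - \<eta> t * (2 * \<rho> + L)))"
    and Q: "(\<Sum>t<k. (\<eta> t)\<^sup>2) \<le> Q"
  shows "best \<eta> k \<le> ((norm (x0 - xs))\<^sup>2 / 2 + noise * Q) / S"
proof -
  \<comment> \<open>As \<open>1 \<le> k\<close>, an admissible step exists, and this forces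
    \<open>2 * \<rho> + L\<close> to be positive; the value 0 is excluded because division by 0
    gives 0.\<close>
  have "0 < \<zeta> / (2 * \<rho> + L)" using \<eta>[of 0] k by auto
  then have c: "0 < 2 * \<rho> + L" using zeta_pos by (simp add: zero_less_divide_iff)
  have w: "0 \<le> \<eta> t * (\<zeta> - \<eta> t * (2 * \<rho> + L))" if "t < k" for t
    using \<eta>[OF that] c by (intro mult_nonneg_nonneg) (auto simp: field_simps)
  have "best \<eta> k * S \<le> best \<eta> k * (\<Sum>t<k. \<eta> t * (\<zeta> - \<eta> t * (2 * \<rho> + L)))"
    by (intro mult_left_mono S best_nonneg k)
  also have "\<dots> = (\<Sum>t<k. \<eta> t * (\<zeta> - \<eta> t * (2 * \<rho> + L)) * best \<eta> k)"
    by (simp add: sum_distrib_left mult.commute)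
  also have "\<dots> \<le> (\<Sum>t<k. \<eta> t * (\<zeta> - \<eta> t * (2 * \<rho> + L)) * (\<integral>\<omega>. gap (iter \<eta> t \<omega>) \<partial>M))"
    using w by (intro sum_mono mult_left_mono best_le) auto
  also have "\<dots> \<le> (norm (x0 - xs))\<^sup>2 / 2 + noise * (\<Sum>t<k. (\<eta> t)\<^sup>2)"
    using \<eta> by (intro descent_sum) (auto intro: less_imp_le)
  also have "\<dots> \<le> (norm (x0 - xs))\<^sup>2 / 2 + noise * Q"
    by (intro add_left_mono mult_left_mono Q noise_nonneg)
  finally show ?thesis using S by (simp add: field_simps)
qed

lemma step_bound_pos: "0 < \<gamma> \<Longrightarrow> \<gamma> < \<zeta> / (2 * \<rho> + L) \<Longrightarrow> 0 < 2 * \<rho> + L"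
  using zeta_pos order_less_trans[of 0 \<gamma> "\<zeta> / (2 * \<rho> + L)"] by (simp add: zero_less_divide_iff)

section \<open>Rates for the step-size rules\<close>

lemma general_rate:
  assumes k: "1 \<le> k" and \<eta>: "\<And>t. t < k \<Longrightarrow> 0 < \<eta> t \<and> \<eta> t < \<zeta> / (2 * \<rho> + L)"
  shows "best \<eta> k \<le> 1 / (\<Sum>i<k. \<eta> i * (\<zeta> - \<eta> i * (2 * \<rho> + L)))
    * ((norm (x0 - xs))\<^sup>2 / 2 + noise * (\<Sum>t<k. (\<eta> t)\<^sup>2))"
proof -
  have c: "0 < 2 * \<rho> + L" using \<eta>[of 0] k by (intro step_bound_pos[of "\<eta> 0"]) auto
  have "0 < \<eta> t * (\<zeta> - \<eta> t * (2 * \<rho> + L))" if "t < k" for t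
    using \<eta>[OF that] c by (intro mult_pos_pos) (auto simp: field_simps)
  then have "0 < (\<Sum>i<k. \<eta> i * (\<zeta> - \<eta> i * (2 * \<rho> + L)))"
    using k by (intro sum_pos) (auto simp: lessThan_empty_iff)
  from best_gap_bound[OF k \<eta> this order_refl order_refl] show ?thesis
    by simp
qed

lemma constant_rate:
  assumes k: "1 \<le> k" and \<gamma>: "0 < \<gamma>" "\<gamma> = 1 / 2 * (\<zeta> / (2 * \<rho> + L))"
  shows "best (\<lambda>_. \<gamma>) k \<le> 2 * (norm (x0 - xs))\<^sup>2 * ((2 * \<rho> + L) / (\<zeta>\<^sup>2 * real k))
    + noise / (2 * \<rho> + L)"
proof -
  define c where "c = 2 * \<rho> + L"
  have \<gamma>c: "\<gamma> = 1 / 2 * (\<zeta> / c)" using \<gamma>(2) by (simp only: c_def)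
  then have \<gamma>_less: "\<gamma> < \<zeta> / c" using \<gamma>(1) by linarith
  then have c: "0 < c" using \<gamma> by (simp only: c_def step_bound_pos)
  have S: "0 < real k * (\<zeta>\<^sup>2 / (4 * c))"
    using k c zeta_pos by simp
  \<comment> \<open>This \<open>\<gamma>\<close> maximizes the quadratic weight, and the right side
    is the maximum.\<close>
  have "\<gamma> * (\<zeta> - \<gamma> * c) = \<zeta>\<^sup>2 / (4 * c)"
    unfolding \<gamma>c using c by (simp add: field_simps power2_eq_square)
  then have "real k * (\<zeta>\<^sup>2 / (4 * c)) \<le> (\<Sum>t<k. \<gamma> * (\<zeta> - \<gamma> * (2 * \<rho> + L)))"
    by (simp add: c_def[symmetric])
  then have "best (\<lambda>_. \<gamma>) k \<le> ((norm (x0 - xs))\<^sup>2 / 2 + noise * (real k * \<gamma>\<^sup>2))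
      / (real k * (\<zeta>\<^sup>2 / (4 * c)))"
    using \<gamma>(1) \<gamma>_less by (intro best_gap_bound[OF k _ S]) (simp_all add: c_def)
  also have "\<dots> = 2 * (norm (x0 - xs))\<^sup>2 * (c / (\<zeta>\<^sup>2 * real k)) + noise / c"
    unfolding \<gamma>c using c k zeta_pos by (simp add: field_simps power2_eq_square)
  finally show ?thesis by (simp only: c_def)
qed

text \<open>The squared steps sum to \<open>\<gamma>\<^sup>2\<close> and the weights to
  \<open>\<gamma> * sqrt T\<close> times the quantity bounded below by \<open>d\<close>. The choice
  \<open>d = 1 / 2\<close> gives the bound without \<open>\<zeta>\<close>, and
  \<open>d = \<zeta> / 2\<close> the one with \<open>\<zeta>\<close> in the denominator.\<close>

lemma horizon_rate:
  assumes T: "1 \<le> T" and \<gamma>: "0 < \<gamma>" "\<gamma> < \<zeta> / (2 * \<rho> + L)"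
    and \<eta>: "\<And>k. k < T \<Longrightarrow> \<eta> k = \<gamma> / sqrt (real T)"
    and d: "0 < d" "d \<le> \<zeta> - \<gamma> * (2 * \<rho> + L) / sqrt (real T)"
  shows "best \<eta> T \<le> ((norm (x0 - xs))\<^sup>2 + 2 * \<gamma>\<^sup>2 * noise) / (2 * d * \<gamma> * sqrt (real T))"
proof -
  define q where "q = sqrt (real T)"
  have q: "1 \<le> q" "q * q = real T" using T by (auto simp: q_def)
  have \<eta>q: "\<eta> t = \<gamma> / q" if "t < T" for t using \<eta>[OF that] by (simp add: q_def)
  have "\<gamma> / q \<le> \<gamma>" using q \<gamma> by (simp add: field_simps)
  then have step: "0 < \<eta> t \<and> \<eta> t < \<zeta> / (2 * \<rho> + L)" if "t < T" for t
    using \<gamma> q \<eta>q[OF that] by auto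
  have S: "0 < \<gamma> * q * d" using \<gamma> q d by simp
  have "(\<Sum>t<T. \<eta> t * (\<zeta> - \<eta> t * (2 * \<rho> + L)))
      = (\<Sum>t<T. \<gamma> / q * (\<zeta> - \<gamma> / q * (2 * \<rho> + L)))"
    by (intro sum.cong refl) (simp add: \<eta>q)
  also have "\<dots> = real T * (\<gamma> / q * (\<zeta> - \<gamma> / q * (2 * \<rho> + L)))"
    by simp
  also have "\<dots> = \<gamma> * q * (\<zeta> - \<gamma> * (2 * \<rho> + L) / q)"
    using q(1) by (simp add: q(2)[symmetric])
  also have "\<dots> \<ge> \<gamma> * q * d"
    using \<gamma> q d by (intro mult_left_mono) (auto simp: q_def)
  finally have "\<gamma> * q * d \<le> (\<Sum>t<T. \<eta> t * (\<zeta> - \<eta> t * (2 * \<rho> + L)))" .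
  moreover have "(\<Sum>t<T. (\<eta> t)\<^sup>2) = (\<Sum>t<T. (\<gamma> / q)\<^sup>2)"
    by (intro sum.cong refl) (simp add: \<eta>q)
  then have "(\<Sum>t<T. (\<eta> t)\<^sup>2) = \<gamma>\<^sup>2"
    using q(1) by (simp add: power2_eq_square q(2)[symmetric])
  ultimately have "best \<eta> T \<le> ((norm (x0 - xs))\<^sup>2 / 2 + noise * \<gamma>\<^sup>2) / (\<gamma> * q * d)"
    using step by (intro best_gap_bound[OF T _ S]) auto
  also have "\<dots> = ((norm (x0 - xs))\<^sup>2 + 2 * \<gamma>\<^sup>2 * noise) / (2 * d * \<gamma> * q)"
    using q \<gamma> d by (simp add: field_simps)
  finally show ?thesis by (simp add: q_def)
qed

text \<open>For \<open>T \<ge> 4\<close> this is \<open>horizon_rate\<close> with \<open>d = \<zeta> / 2\<close>. For \<open>T \<le> 3\<close> that choice of \<open>d\<close> may fail,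
  but smoothness bounds the gap of the starting point itself by \<open>L / 2 * (norm (x0 - xs))\<^sup>2\<close>.\<close>

lemma horizon_rate_quasar:
  assumes T: "1 \<le> T" and \<gamma>: "0 < \<gamma>" "\<gamma> < \<zeta> / (2 * \<rho> + L)" and "\<zeta> \<le> 1"
    and \<eta>: "\<And>k. k < T \<Longrightarrow> \<eta> k = \<gamma> / sqrt (real T)"
  shows "best \<eta> T \<le> ((norm (x0 - xs))\<^sup>2 + 2 * \<gamma>\<^sup>2 * noise) / (\<zeta> * \<gamma> * sqrt (real T))"
proof -
  have c: "0 < 2 * \<rho> + L" using \<gamma> by (rule step_bound_pos)
  have \<gamma>c: "\<gamma> * (2 * \<rho> + L) < \<zeta>" using \<gamma> c by (simp add: field_simps)
  have q: "0 < sqrt (real T)" using T by simp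
  show ?thesis
  proof (cases "4 \<le> T")
    case True
    then have "sqrt 4 \<le> sqrt (real T)" by (intro real_sqrt_le_mono) simp
    then have "2 \<le> sqrt (real T)" by simp
    then have "\<zeta> * 2 \<le> \<zeta> * sqrt (real T)" using zeta_pos by (intro mult_left_mono) auto
    then have "\<gamma> * (2 * \<rho> + L) / sqrt (real T) \<le> \<zeta> / 2"
      using \<gamma>c q by (simp add: divide_le_eq)
    then have "\<zeta> / 2 \<le> \<zeta> - \<gamma> * (2 * \<rho> + L) / sqrt (real T)" by simp
    from horizon_rate[OF T \<gamma> \<eta> _ this] show ?thesis
      using zeta_pos by simp
  next
    case False
    then have "sqrt (real T) \<le> sqrt 4" by (intro real_sqrt_le_mono) simp
    then have q2: "sqrt (real T) \<le> 2" by simp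
    have "best \<eta> T \<le> (\<integral>\<omega>. gap (iter \<eta> 0 \<omega>) \<partial>M)"
      using T by (intro best_le) auto
    also have "\<dots> = gap x0" by (simp add: M.prob_space)
    also have "gap x0 * (\<zeta> * \<gamma> * sqrt (real T)) \<le> (norm (x0 - xs))\<^sup>2"
    \<comment> \<open>A positive gap gives \<open>0 \<le> \<rho>\<close>, hence \<open>L * \<gamma>
      \<le> \<gamma> * (2 * \<rho> + L) < \<zeta> \<le> 1\<close>; with
      \<open>\<zeta> * sqrt T \<le> 2\<close> the factor 2 cancels the half in
      \<open>gap_le\<close>.\<close>
    proof (cases "gap x0 = 0")
      case False
      then have "0 < gap x0" using gap_nonneg[of x0] by simp
      then have "0 \<le> \<rho>" using rho_gap_nonneg[of x0] by (simp add: zero_le_mult_iff)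
      have "L * \<gamma> \<le> \<gamma> * (2 * \<rho> + L)" using \<open>0 \<le> \<rho>\<close> \<gamma> by (simp add: algebra_simps)
      then have L\<gamma>: "L * \<gamma> \<le> 1" using \<gamma>c \<open>\<zeta> \<le> 1\<close> by linarith
      have "\<zeta> * sqrt (real T) \<le> 1 * 2"
        using \<open>\<zeta> \<le> 1\<close> zeta_pos q2 q by (intro mult_mono) auto
      have "gap x0 * (\<zeta> * \<gamma> * sqrt (real T)) = gap x0 * \<gamma> * (\<zeta> * sqrt (real T))"
        by simp
      also have "\<dots> \<le> gap x0 * \<gamma> * 2"
        using \<open>\<zeta> * sqrt (real T) \<le> 1 * 2\<close> gap_nonneg[of x0] \<gamma> by (intro mult_left_mono) auto
      also have "\<dots> \<le> L / 2 * (norm (x0 - xs))\<^sup>2 * \<gamma> * 2"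
        using gap_le[of x0] \<gamma> by (intro mult_right_mono) auto
      also have "\<dots> = L * \<gamma> * (norm (x0 - xs))\<^sup>2" by simp
      also have "\<dots> \<le> 1 * (norm (x0 - xs))\<^sup>2"
        using L\<gamma> by (intro mult_right_mono) auto
      finally show ?thesis by simp
    qed simp
    then have "gap x0 \<le> (norm (x0 - xs))\<^sup>2 / (\<zeta> * \<gamma> * sqrt (real T))"
      using zeta_pos \<gamma> q by (simp add: pos_le_divide_eq)
    also have "\<dots> \<le> ((norm (x0 - xs))\<^sup>2 + 2 * \<gamma>\<^sup>2 * noise) / (\<zeta> * \<gamma> * sqrt (real T))"
      using zeta_pos \<gamma> q noise_nonneg by (intro divide_right_mono) auto
    finally show ?thesis .
  qed
qed

text \<open>The logarithm bounds the harmonic sum, and \<open>2 * \<gamma> * ?D\<close> bounds the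
  total weight from below. Positivity of \<open>?D\<close> is a real restriction: at
  \<open>k = 1\<close> it equals \<open>- \<gamma> * (\<rho> + L / 2)\<close>, which is
  negative.\<close>

lemma decreasing_rate:
  assumes k: "1 \<le> k" and \<gamma>: "0 < \<gamma>" "\<gamma> < \<zeta> / (2 * \<rho> + L)"
    and D: "0 < \<zeta> * (sqrt (real k) - 1) - \<gamma> * (\<rho> + L / 2) * (ln (real k) + 1)" (is "0 < ?D")
  shows "best (\<lambda>k. \<gamma> / sqrt (real (k + 1))) k
    \<le> 1 / (4 * \<gamma>) * (((norm (x0 - xs))\<^sup>2 + 2 * \<gamma>\<^sup>2 * noise * (ln (real k) + 1)) / ?D)"
proof -
  define c where "c = 2 * \<rho> + L"
  have c: "0 < c" using \<gamma> by (simp add: c_def step_bound_pos)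
  have step: "0 < \<gamma> / sqrt (real (t + 1)) \<and> \<gamma> / sqrt (real (t + 1)) < \<zeta> / (2 * \<rho> + L)" for t
  proof -
    have "\<gamma> / sqrt (real (t + 1)) \<le> \<gamma> / 1"
      using \<gamma> by (intro divide_left_mono) auto
    then show ?thesis using \<gamma> by auto
  qed
  have sq: "(\<gamma> / sqrt (real (t + 1)))\<^sup>2 = \<gamma>\<^sup>2 * (1 / real (t + 1))" for t
    by (simp add: power_divide)
  have "2 * \<gamma> * ?D = \<gamma> * \<zeta> * (2 * (sqrt (real k) - 1)) - \<gamma>\<^sup>2 * c * (ln (real k) + 1)"
    by (simp add: c_def power2_eq_square algebra_simps)
  also have "\<dots> \<le> \<gamma> * \<zeta> * (\<Sum>t<k. 1 / sqrt (real (t + 1))) - \<gamma>\<^sup>2 * c * (\<Sum>t<k. 1 / real (t + 1))"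
  proof (intro diff_mono mult_left_mono sum_inverse_le_ln k)
    \<comment> \<open>The comparison gives \<open>sqrt (k + 1)\<close>; it is weakened to
      \<open>sqrt k\<close> to match \<open>?D\<close>.\<close>
    have "2 * (sqrt (real k) - 1) \<le> 2 * (sqrt (real (k + 1)) - 1)" by simp
    also note sum_inverse_sqrt_ge
    finally show "2 * (sqrt (real k) - 1) \<le> (\<Sum>t<k. 1 / sqrt (real (t + 1)))" .
  qed (use c \<gamma> zeta_pos in auto)
  also have "\<dots> = (\<Sum>t<k. \<gamma> * \<zeta> * (1 / sqrt (real (t + 1))) - c * (\<gamma> / sqrt (real (t + 1)))\<^sup>2)"
    by (simp only: sum_subtractf sum_distrib_left sq mult_ac)
  also have "\<dots> = (\<Sum>t<k. \<gamma> / sqrt (real (t + 1)) * (\<zeta> - \<gamma> / sqrt (real (t + 1)) * (2 * \<rho> + L)))"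
    by (intro sum.cong refl) (simp add: c_def[symmetric] right_diff_distrib power2_eq_square)
  finally have S: "2 * \<gamma> * ?D
      \<le> (\<Sum>t<k. \<gamma> / sqrt (real (t + 1)) * (\<zeta> - \<gamma> / sqrt (real (t + 1)) * (2 * \<rho> + L)))" .
  have Q: "(\<Sum>t<k. (\<gamma> / sqrt (real (t + 1)))\<^sup>2) \<le> \<gamma>\<^sup>2 * (ln (real k) + 1)"
    unfolding sq sum_distrib_left[symmetric] by (intro mult_left_mono sum_inverse_le_ln k) simp
  have "0 < 2 * \<gamma> * ?D" using D \<gamma> by simp
  from best_gap_bound[OF k step this S Q]
  have "best (\<lambda>k. \<gamma> / sqrt (real (k + 1))) k
    \<le> ((norm (x0 - xs))\<^sup>2 / 2 + noise * (\<gamma>\<^sup>2 * (ln (real k) + 1))) / (2 * \<gamma> * ?D)" .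
  also have "\<dots> = 1 / (4 * \<gamma>) * (((norm (x0 - xs))\<^sup>2 + 2 * \<gamma>\<^sup>2 * noise * (ln (real k) + 1)) / ?D)"
  proof -
    have "(a / 2 + n * (g * l)) / (2 * \<gamma> * D) = 1 / (4 * \<gamma>) * ((a + 2 * g * n * l) / D)"
      if "0 < D" for a n g l D :: real
      using that \<gamma> by (simp add: field_simps)
    then show ?thesis using D .
  qed
  finally show ?thesis .
qed

text \<open>\<open>?D k\<close> is eventually positive because the square root outgrows the
  logarithm; from then on the minimal gap lies between 0 and \<open>?B k\<close>.\<close>

lemma decreasing_rate_bigo:
  assumes \<gamma>: "0 < \<gamma>" "\<gamma> < \<zeta> / (2 * \<rho> + L)"
  shows "best (\<lambda>k. \<gamma> / sqrt (real (k + 1))) \<in> O(\<lambda>k. ln (real k) / sqrt (real k))"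
proof -
  let ?D = "\<lambda>k. \<zeta> * (sqrt (real k) - 1) - \<gamma> * (\<rho> + L / 2) * (ln (real k) + 1)"
  let ?B = "\<lambda>k. 1 / (4 * \<gamma>) * (((norm (x0 - xs))\<^sup>2 + 2 * \<gamma>\<^sup>2 * noise * (ln (real k) + 1)) / ?D k)"
  have "\<forall>\<^sub>F k in sequentially. 0 < ?D k"
    using zeta_pos by real_asymp
  then have "\<forall>\<^sub>F k in sequentially.
      norm (best (\<lambda>k. \<gamma> / sqrt (real (k + 1))) k) \<le> norm (?B k)"
    using eventually_ge_at_top[of 1]
  proof eventually_elim
    case (elim k)
    from decreasing_rate[OF elim(2) \<gamma> elim(1)]
      best_nonneg[OF elim(2), of "\<lambda>k. \<gamma> / sqrt (real (k + 1))"]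
    show ?case unfolding real_norm_def by linarith
  qed
  then show ?thesis
    by (rule landau_o.big_mono[THEN landau_o.big_trans])
      (rule decreasing_bound_bigo[OF \<gamma>(1) zeta_pos])
qed

end

text \<open>The integrability clause ensures that no expectation in \<open>best_gap\<close> is a
  default value, and \<open>k \<ge> 1\<close> keeps the minimum over a nonempty set. The
  fixed-horizon rate comes in two forms: one with \<open>\<zeta>\<close> in the denominator for
  every \<open>T \<ge> 1\<close>, and one without it when the averaged weight factor is at least
  1/2.\<close>

theorem theorem4p1:
  fixes f :: "'n::finite \<Rightarrow> real ^ 'd::finite \<Rightarrow> real"
    and N :: "'u measure" and v :: "'u \<Rightarrow> real ^ 'n"
    and M :: "'w measure" and V :: "nat \<Rightarrow> 'w \<Rightarrow> real ^ 'n"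
    and xs x0 :: "real ^ 'd"
    and L \<zeta> \<rho> \<sigma>2 r0 :: real
  assumes "\<And>i x. f i differentiable (at x)"
    and "xs \<in> minimizers (objective f)"
    and "prob_space N" and "sampling_vector N v"
    and "prob_space M" and "iid_copies M V N v"
    and "gradient_noise N v f < \<infinity>"
    and "\<sigma>2 = enn2real (gradient_noise N v f)"
    and "smooth L (objective f)"
    and "0 < \<zeta>" and "\<zeta> \<le> 1"
    and "quasar_convex \<zeta> (objective f) xs"
    and "expected_residual N v f xs \<rho>"
    and "r0 = (norm (x0 - xs))\<^sup>2"
  shows
    "(\<forall>\<eta> t. integrable M (\<lambda>\<omega>. objective f (sgd f V x0 \<eta> t \<omega>) - objective f xs)) \<and>
     (\<forall>\<eta>. (\<forall>k. 0 < \<eta> k \<and> \<eta> k < \<zeta> / (2 * \<rho> + L)) \<longrightarrow>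
        (\<forall>k\<ge>1. best_gap M (objective f) xs (sgd f V x0 \<eta>) k
           \<le> 1 / (\<Sum>i<k. \<eta> i * (\<zeta> - \<eta> i * (2 * \<rho> + L)))
              * (r0 / 2 + \<sigma>2 * (\<Sum>t<k. (\<eta> t)\<^sup>2)))) \<and>
     (\<forall>\<gamma>. 0 < \<gamma> \<and> \<gamma> < \<zeta> / (2 * \<rho> + L) \<longrightarrow>
        (\<gamma> = 1 / 2 * (\<zeta> / (2 * \<rho> + L)) \<longrightarrow>
          (\<forall>k\<ge>1. best_gap M (objective f) xs (sgd f V x0 (\<lambda>_. \<gamma>)) k
             \<le> 2 * r0 * ((2 * \<rho> + L) / (\<zeta>\<^sup>2 * real k)) + \<sigma>2 / (2 * \<rho> + L))) \<and>
        (\<forall>T\<ge>1. \<forall>\<eta>. (\<forall>k<T. \<eta> k = \<gamma> / sqrt (real T)) \<longrightarrow>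
          best_gap M (objective f) xs (sgd f V x0 \<eta>) T
             \<le> (r0 + 2 * \<gamma>\<^sup>2 * \<sigma>2) / (\<zeta> * \<gamma> * sqrt (real T)) \<and>
          (1 / 2 \<le> \<zeta> - \<gamma> * (2 * \<rho> + L) / sqrt (real T) \<longrightarrow>
             best_gap M (objective f) xs (sgd f V x0 \<eta>) T
               \<le> (r0 + 2 * \<gamma>\<^sup>2 * \<sigma>2) / (\<gamma> * sqrt (real T)))) \<and>
        (let \<eta> = (\<lambda>k. \<gamma> / sqrt (real (k + 1)));
             D = (\<lambda>k. \<zeta> * (sqrt (real k) - 1) - \<gamma> * (\<rho> + L / 2) * (ln (real k) + 1));
             B = (\<lambda>k. 1 / (4 * \<gamma>) * ((r0 + 2 * \<gamma>\<^sup>2 * \<sigma>2 * (ln (real k) + 1)) / D k))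
         in (\<forall>k\<ge>1. 0 < D k \<longrightarrow> best_gap M (objective f) xs (sgd f V x0 \<eta>) k \<le> B k) \<and>
            B \<in> O(\<lambda>k. ln (real k) / sqrt (real k)) \<and>
            best_gap M (objective f) xs (sgd f V x0 \<eta>) \<in> O(\<lambda>k. ln (real k) / sqrt (real k))))"
proof -
  interpret sgd_problem M N f v V xs x0 L \<zeta> \<rho>
    by (rule sgd_problem.intro[OF assms(5,3) sgd_problem_axioms.intro[OF assms(1,2,4,6,7,9,10,12,13)]])
  have \<sigma>2: "\<sigma>2 = noise" using assms(8) by (simp add: noise_def)
  note defs = \<sigma>2 assms(14) Let_def
  show ?thesis
    unfolding defs
  proof (intro conjI allI impI; (elim conjE)?)
    fix \<eta> t
    show "integrable M (\<lambda>\<omega>. objective f (iter \<eta> t \<omega>) - objective f xs)"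
      using integrable_gap by (simp add: gap_def)
  next
    fix \<eta> :: "nat \<Rightarrow> real" and k :: nat
    assume "\<forall>k. 0 < \<eta> k \<and> \<eta> k < \<zeta> / (2 * \<rho> + L)" "1 \<le> k"
    then show "best \<eta> k \<le> 1 / (\<Sum>i<k. \<eta> i * (\<zeta> - \<eta> i * (2 * \<rho> + L)))
        * ((norm (x0 - xs))\<^sup>2 / 2 + noise * (\<Sum>t<k. (\<eta> t)\<^sup>2))"
      by (intro general_rate) auto
  next
    fix \<gamma> :: real and k :: nat
    assume "0 < \<gamma>" "\<gamma> = 1 / 2 * (\<zeta> / (2 * \<rho> + L))" "1 \<le> k"
    then show "best (\<lambda>_. \<gamma>) k \<le> 2 * (norm (x0 - xs))\<^sup>2 * ((2 * \<rho> + L) / (\<zeta>\<^sup>2 * real k))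
        + noise / (2 * \<rho> + L)"
      by (intro constant_rate)
  next
    fix \<gamma> :: real and T :: nat and \<eta> :: "nat \<Rightarrow> real"
    assume "0 < \<gamma>" "\<gamma> < \<zeta> / (2 * \<rho> + L)" "1 \<le> T" "\<forall>k<T. \<eta> k = \<gamma> / sqrt (real T)"
    then show "best \<eta> T \<le> ((norm (x0 - xs))\<^sup>2 + 2 * \<gamma>\<^sup>2 * noise) / (\<zeta> * \<gamma> * sqrt (real T))"
      using assms(11) by (intro horizon_rate_quasar) auto
  next
    fix \<gamma> :: real and T :: nat and \<eta> :: "nat \<Rightarrow> real"
    assume "0 < \<gamma>" "\<gamma> < \<zeta> / (2 * \<rho> + L)" "1 \<le> T" "\<forall>k<T. \<eta> k = \<gamma> / sqrt (real T)"
      and "1 / 2 \<le> \<zeta> - \<gamma> * (2 * \<rho> + L) / sqrt (real T)"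
    then show "best \<eta> T \<le> ((norm (x0 - xs))\<^sup>2 + 2 * \<gamma>\<^sup>2 * noise) / (\<gamma> * sqrt (real T))"
      using horizon_rate[of T \<gamma> \<eta> "1 / 2"] by simp
  next
    fix \<gamma> :: real and k :: nat
    assume "0 < \<gamma>" "\<gamma> < \<zeta> / (2 * \<rho> + L)" "1 \<le> k"
      and "0 < \<zeta> * (sqrt (real k) - 1) - \<gamma> * (\<rho> + L / 2) * (ln (real k) + 1)"
    then show "best (\<lambda>k. \<gamma> / sqrt (real (k + 1))) k
        \<le> 1 / (4 * \<gamma>) * (((norm (x0 - xs))\<^sup>2 + 2 * \<gamma>\<^sup>2 * noise * (ln (real k) + 1))
          / (\<zeta> * (sqrt (real k) - 1) - \<gamma> * (\<rho> + L / 2) * (ln (real k) + 1)))"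
      by (intro decreasing_rate)
  next
    fix \<gamma> :: real
    assume \<gamma>: "0 < \<gamma>"
    show "(\<lambda>k. 1 / (4 * \<gamma>) * (((norm (x0 - xs))\<^sup>2 + 2 * \<gamma>\<^sup>2 * noise * (ln (real k) + 1))
        / (\<zeta> * (sqrt (real k) - 1) - \<gamma> * (\<rho> + L / 2) * (ln (real k) + 1))))
      \<in> O(\<lambda>k. ln (real k) / sqrt (real k))"
      by (rule decreasing_bound_bigo[OF \<gamma> zeta_pos])
  next
    fix \<gamma> :: real
    assume "0 < \<gamma>" "\<gamma> < \<zeta> / (2 * \<rho> + L)"
    then show "best (\<lambda>k. \<gamma> / sqrt (real (k + 1))) \<in> O(\<lambda>k. ln (real k) / sqrt (real k))"
      by (rule decreasing_rate_bigo)
  qed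
qed

end
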